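(* Let $K$ be a non-centrable (nonempty) compact convex set in a normed plane $\mathbb{M}^2=(\mathbb{R}^2,\|\cdot\|)$, and let $B(x,\lambda_K)$ be a minimal enclosing ball of $K$. Then there exist $m\in\{2,3\}$ and $m$ points $t_1,\dots,t_m\in\operatorname{cr}(K,x)$ that are the vertices of an $(m-1)$-simplex such that $$x\in\operatorname{relint}(\operatorname{conv}\{t_1,\dots,t_m\}).$$
   Context: $B(x,\lambda)=\{y:\|y-x\|\le\lambda\}$ denotes the closed ball with center $x$ and radius $\lambda$. For a nonempty bounded set $K$, $\operatorname{diam}(K)=\sup\{\|x-y\|:x,y\in K\}$. The minimal enclosing radius $\lambda_K$ is the smallest number such that $K\subseteq B(x,\lambda_K)$ for some $x$; such a ball $B(x,\lambda_K)$ is a minimal enclosing ball of $K$. $K$ is centrable if $\operatorname{diam}(K)=2\lambda_K$, and non-centrable otherwise. For a minimal enclosing ball $B(x,\lambda_K)$ of $K$, the critical set $\operatorname{cr}(K,x)$ is the set of all boundary points of $K$ which belong to the boundary of $B(x,\lambda_K)$. $\operatorname{relint}$ denotes relative interior and $\operatorname{conv}$ convex hull. *)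

theory Defs
  imports "HOL-Analysis.Analysis"
begin

text \<open>
  A normed plane is \<open>real ^ 2\<close> together with an arbitrary norm \<open>N\<close>, which need not be the
  Euclidean norm of the type class. All norms on \<open>real ^ 2\<close> induce the same topology, so the
  library notions \<open>compact\<close>, \<open>frontier\<close> and \<open>rel_interior\<close> are used as they stand; only the
  metric notions depend on \<open>N\<close>.
\<close>

definition is_norm :: "(real ^ 2 \<Rightarrow> real) \<Rightarrow> bool" where
  "is_norm N \<longleftrightarrow>
     (\<forall>x. 0 \<le> N x) \<and>
     (\<forall>x. N x = 0 \<longleftrightarrow> x = 0) \<and>
     (\<forall>a x. N (a *\<^sub>R x) = \<bar>a\<bar> * N x) \<and>
     (\<forall>x y. N (x + y) \<le> N x + N y)"

definition norm_cball :: "(real ^ 2 \<Rightarrow> real) \<Rightarrow> real ^ 2 \<Rightarrow> real \<Rightarrow> (real ^ 2) set" where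
  "norm_cball N x r = {y. N (y - x) \<le> r}"

definition norm_diam :: "(real ^ 2 \<Rightarrow> real) \<Rightarrow> (real ^ 2) set \<Rightarrow> real" where
  "norm_diam N K = Sup {N (x - y) | x y. x \<in> K \<and> y \<in> K}"

text \<open>
  For nonempty bounded \<open>K\<close> the minimum below exists, by compactness of closed balls.
  Negative radii play no role, since they give empty balls.
\<close>

definition min_encl_radius :: "(real ^ 2 \<Rightarrow> real) \<Rightarrow> (real ^ 2) set \<Rightarrow> real" where
  "min_encl_radius N K = (LEAST r. \<exists>x. K \<subseteq> norm_cball N x r)"

text \<open>A minimal enclosing ball is represented by its center.\<close>

definition is_min_encl_center :: "(real ^ 2 \<Rightarrow> real) \<Rightarrow> (real ^ 2) set \<Rightarrow> real ^ 2 \<Rightarrow> bool" where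
  "is_min_encl_center N K x \<longleftrightarrow> K \<subseteq> norm_cball N x (min_encl_radius N K)"

definition centrable :: "(real ^ 2 \<Rightarrow> real) \<Rightarrow> (real ^ 2) set \<Rightarrow> bool" where
  "centrable N K \<longleftrightarrow> norm_diam N K = 2 * min_encl_radius N K"

definition critical_set :: "(real ^ 2 \<Rightarrow> real) \<Rightarrow> (real ^ 2) set \<Rightarrow> real ^ 2 \<Rightarrow> (real ^ 2) set" where
  "critical_set N K x = frontier K \<inter> frontier (norm_cball N x (min_encl_radius N K))"

end

theory Submission imports Defs begin

text \<open>
  Write \<open>C\<close> for the points of \<open>K - x\<close> of maximal norm \<open>r\<close>. If \<open>0\<close> were not in the convex hull of
  \<open>C\<close>, then \<open>C\<close> would lie in an open half-plane, hence in the cone spanned by two extreme elements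
  \<open>p\<close>, \<open>q\<close> of \<open>C\<close>. As \<open>K\<close> is non-centrable, \<open>N (p - q) < 2 * r\<close>, and this makes \<open>p + q\<close> a direction
  in which the center can be moved away from \<open>x\<close> so that the radius drops, a contradiction.
  A subset of \<open>C\<close> of least cardinality whose convex hull contains \<open>0\<close> is then the required simplex.
\<close>

section \<open>Norms on the plane: continuity and comparison with the Euclidean norm\<close>

context
  fixes N :: "real ^ 2 \<Rightarrow> real"
  assumes N: "is_norm N"
begin

lemma is_norm_nonneg: "0 \<le> N x"
  and is_norm_eq_0: "N x = 0 \<longleftrightarrow> x = 0"
  and is_norm_scaleR: "N (a *\<^sub>R x) = \<bar>a\<bar> * N x"
  and is_norm_triangle: "N (x + y) \<le> N x + N y"
  using N by (auto simp: is_norm_def)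

lemma is_norm_minus: "N (- x) = N x"
  using is_norm_scaleR[of "-1" x] by simp

lemma is_norm_triangle_diff: "N (x - y) \<le> N x + N y"
  using is_norm_triangle[of x "- y"] by (simp add: is_norm_minus)

text \<open>Convexity is wanted for continuity: in finite dimension a convex function on an open set
  is continuous.\<close>

lemma is_norm_convex: "convex_on UNIV N"
proof (rule convex_onI)
  fix t :: real and x y assume "0 < t" "t < 1"
  then show "N ((1 - t) *\<^sub>R x + t *\<^sub>R y) \<le> (1 - t) * N x + t * N y"
    using is_norm_triangle[of "(1 - t) *\<^sub>R x" "t *\<^sub>R y"] by (simp add: is_norm_scaleR)
qed auto

lemma is_norm_continuous_on: "continuous_on UNIV N"
  by (rule convex_on_continuous[OF open_UNIV is_norm_convex])

lemma is_norm_continuous_on_comp [continuous_intros]: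
  "continuous_on S f \<Longrightarrow> continuous_on S (\<lambda>x. N (f x))"
  using continuous_on_compose2[OF is_norm_continuous_on] by auto

text \<open>Homogeneity reduces this to the Euclidean unit sphere, where the continuous
  \<open>N\<close> attains a positive minimum \<open>m\<close>. It makes \<open>N\<close>-bounded
  sets bounded in the Euclidean sense.\<close>

lemma norm_le_is_norm: obtains m where "m > 0" "\<And>x. m * norm x \<le> N x"
proof -
  obtain z :: "real ^ 2" where z: "z \<in> sphere 0 1" "\<And>y. y \<in> sphere 0 1 \<Longrightarrow> N z \<le> N y"
    using continuous_attains_inf[of "sphere (0 :: real ^ 2) 1" N]
      continuous_on_subset[OF is_norm_continuous_on] by auto
  have "z \<noteq> 0" using z(1) by auto
  then have "N z > 0" using is_norm_nonneg[of z] is_norm_eq_0[of z] by linarith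
  moreover have "N z * norm x \<le> N x" for x
  proof (cases "x = 0")
    case False
    then have "N z \<le> N (x /\<^sub>R norm x)" by (intro z(2)) simp
    then show ?thesis using False by (simp add: is_norm_scaleR field_simps)
  qed (simp add: is_norm_nonneg)
  ultimately show thesis by (rule that)
qed

section \<open>The minimal enclosing radius and the distances within \<open>K\<close>\<close>

lemma min_encl_radius_le:
  assumes "K \<noteq> {}" "compact K" "K \<subseteq> norm_cball N z r"
  shows "min_encl_radius N K \<le> r"
proof -
  \<comment> \<open>\<open>LEAST\<close> over the reals says nothing until a minimum is known to
    exist. \<open>P\<close> collects the pairs (radius, center) of enclosing balls; the cap
    \<open>r\<close> on the radius makes it compact, so \<open>fst\<close> attains its minimum on
    it.\<close>
  define P where "P = {w :: real \<times> (real ^ 2). fst w \<le> r \<and> (\<forall>y\<in>K. N (y - snd w) \<le> fst w)}"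
  obtain y0 where y0: "y0 \<in> K" using assms by auto
  obtain m where m: "m > 0" "\<And>x. m * norm x \<le> N x" by (rule norm_le_is_norm) blast
  have "closed P"
  proof -
    have "P = {w. fst w \<le> r} \<inter> (\<Inter>y\<in>K. {w. N (y - snd w) \<le> fst w})"
      by (auto simp: P_def)
    then show ?thesis
      by (auto intro!: closed_Int closed_INT closed_Collect_le continuous_intros)
  qed
  moreover have "bounded P"
  proof -
    have "P \<subseteq> {0..r} \<times> cball y0 (r / m)"
    proof
      fix w assume w: "w \<in> P"
      then have *: "N (y0 - snd w) \<le> fst w" "fst w \<le> r" using y0 by (auto simp: P_def)
      then have "m * norm (y0 - snd w) \<le> r" using m(2)[of "y0 - snd w"] by linarith
      then have "dist y0 (snd w) \<le> r / m" using m(1) by (simp add: dist_norm field_simps)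
      then show "w \<in> {0..r} \<times> cball y0 (r / m)"
        using * is_norm_nonneg[of "y0 - snd w"] by (auto simp: mem_Times_iff)
    qed
    then show ?thesis by (rule bounded_subset[rotated]) (auto intro!: bounded_Times)
  qed
  ultimately have "compact P" by (simp add: compact_eq_bounded_closed)
  moreover have rz: "(r, z) \<in> P" using assms(3) by (auto simp: P_def norm_cball_def)
  ultimately obtain w where w: "w \<in> P" "\<And>w'. w' \<in> P \<Longrightarrow> fst w \<le> fst w'"
    using continuous_attains_inf[of P fst] continuous_on_fst[OF continuous_on_id] by blast
  have "min_encl_radius N K = fst w"
    unfolding min_encl_radius_def
  proof (rule Least_equality)
    show "\<exists>z. K \<subseteq> norm_cball N z (fst w)"
      using w(1) by (auto simp: P_def norm_cball_def intro!: exI[of _ "snd w"])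
    fix s assume "\<exists>z. K \<subseteq> norm_cball N z s"
    then obtain u where u: "K \<subseteq> norm_cball N u s" by auto
    show "fst w \<le> s"
    \<comment> \<open>A ball of radius above \<open>r\<close> is not represented in
      \<open>P\<close>, but then \<open>s\<close> exceeds \<open>r\<close>, which already bounds
      \<open>fst w\<close>.\<close>
    proof (cases "s \<le> r")
      case True
      then have "(s, u) \<in> P" using u by (auto simp: P_def norm_cball_def)
      then show ?thesis using w(2) by fastforce
    next
      case False
      then show ?thesis using w(2)[OF rz] by simp
    qed
  qed
  then show ?thesis using w(2)[OF rz] by simp
qed

text \<open>Going through \<open>x\<close> bounds every distance in \<open>K\<close> by twice the
  radius, so a pair attaining this bound would make \<open>K\<close> centrable. With
  \<open>y = z\<close> the lemma also shows that the radius is positive.\<close>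

lemma not_centrable_dist_less:
  assumes "\<not> centrable N K" "is_min_encl_center N K x" "y \<in> K" "z \<in> K"
  shows "N (y - z) < 2 * min_encl_radius N K"
proof (rule ccontr)
  assume far: "\<not> N (y - z) < 2 * min_encl_radius N K"
  have le: "N (u - v) \<le> 2 * min_encl_radius N K" if "u \<in> K" "v \<in> K" for u v
  proof -
    have "N (u - x) \<le> min_encl_radius N K" "N (v - x) \<le> min_encl_radius N K"
      using that assms(2) by (auto simp: is_min_encl_center_def norm_cball_def)
    then show ?thesis using is_norm_triangle_diff[of "u - x" "v - x"] by simp
  qed
  have "norm_diam N K = 2 * min_encl_radius N K"
    unfolding norm_diam_def
  proof (rule cSup_eq_maximum)
    show "2 * min_encl_radius N K \<in> {N (x - y) |x y. x \<in> K \<and> y \<in> K}"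
      using far le[OF assms(3,4)] assms(3,4) by force
  qed (use le in auto)
  then show False using assms(1) by (simp add: centrable_def)
qed

section \<open>Moving the center in an improving direction\<close>

lemma norm_diff_less_in_cone:
  assumes "0 < r" "N p = r" "N q = r" "N (p - q) < 2 * r"
    and c: "N c = r" "c = a *\<^sub>R p + b *\<^sub>R q" and "0 \<le> a" "0 \<le> b"
  shows "\<exists>e>0. N (c - e *\<^sub>R (p + q)) < r"
proof -
  \<comment> \<open>Each of \<open>a *\<^sub>R p\<close> and \<open>b *\<^sub>R q\<close> is
    \<open>c\<close> minus the other, so their norms \<open>a * r\<close> and \<open>b * r\<close>
    differ by at most \<open>r\<close>.\<close>
  have "N (a *\<^sub>R p) \<le> N c + N (b *\<^sub>R q)" "N (b *\<^sub>R q) \<le> N c + N (a *\<^sub>R p)"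
    using is_norm_triangle_diff[of c "b *\<^sub>R q"] is_norm_triangle_diff[of c "a *\<^sub>R p"] c(2) by auto
  then have "a * r \<le> (1 + b) * r" "b * r \<le> (1 + a) * r"
    using assms by (auto simp: is_norm_scaleR algebra_simps)
  then have ab: "\<bar>a - b\<bar> \<le> 1" using \<open>0 < r\<close> by (simp add: abs_le_iff)
  have "a + b \<noteq> 0"
    using assms is_norm_eq_0[of 0] by (auto simp: add_nonneg_eq_0_iff)
  then have "a + b > 0" using assms by linarith
  \<comment> \<open>Subtracting the mean of the two coefficients leaves only a multiple of
    \<open>p - q\<close> by a factor of modulus at most 1/2, and
    \<open>N (p - q) < 2 * r\<close>.\<close>
  have "c - ((a + b) / 2) *\<^sub>R (p + q) = ((a - b) / 2) *\<^sub>R (p - q)"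
    unfolding c(2) by (simp add: vec_eq_iff field_simps)
  then have "N (c - ((a + b) / 2) *\<^sub>R (p + q)) = \<bar>a - b\<bar> / 2 * N (p - q)"
    by (simp add: is_norm_scaleR)
  also have "\<dots> \<le> 1 / 2 * N (p - q)"
    using ab is_norm_nonneg by (intro mult_right_mono) auto
  finally show ?thesis
    using assms(4) \<open>a + b > 0\<close> by (intro exI[of _ "(a + b) / 2"]) auto
qed

text \<open>The shorter step ends on the segment from \<open>c\<close> to
  \<open>c - e *\<^sub>R v\<close>, at a point other than \<open>c\<close>, so convexity gives a
  strict inequality. This lets one step length replace finitely many.\<close>

lemma norm_diff_less_mono:
  assumes "N c \<le> r" "N (c - e *\<^sub>R v) < r" "0 < s" "s \<le> e"
  shows "N (c - s *\<^sub>R v) < r"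
proof -
  have "c - s *\<^sub>R v = (1 - s / e) *\<^sub>R c + (s / e) *\<^sub>R (c - e *\<^sub>R v)"
    using assms by (simp add: algebra_simps)
  then have "N (c - s *\<^sub>R v) \<le> (1 - s / e) * N c + (s / e) * N (c - e *\<^sub>R v)"
    using is_norm_triangle[of "(1 - s / e) *\<^sub>R c" "(s / e) *\<^sub>R (c - e *\<^sub>R v)"] assms
    by (simp add: is_norm_scaleR)
  also have "\<dots> < (1 - s / e) * r + (s / e) * r"
    using assms by (intro add_le_less_mono mult_left_mono mult_strict_left_mono) auto
  also have "\<dots> = r" by (simp add: algebra_simps)
  finally show ?thesis .
qed

text \<open>The improving step length depends on \<open>y\<close>, but the same step still works
  near \<open>y\<close>. Compactness leaves finitely many lengths, and the smallest of them serves
  all of \<open>K\<close>.\<close>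

lemma uniformly_improving_shift:
  assumes "compact K" and le: "\<And>y. y \<in> K \<Longrightarrow> N (y - x) \<le> r"
    and impr: "\<And>y. y \<in> K \<Longrightarrow> N (y - x) = r \<Longrightarrow> \<exists>e>0. N (y - x - e *\<^sub>R v) < r"
  shows "\<exists>z. \<forall>y\<in>K. N (y - z) < r"
proof -
  define U where "U e = {y. N (y - x - e *\<^sub>R v) < r}" for e
  have "open (U e)" for e
    unfolding U_def by (intro open_Collect_less continuous_intros)
  moreover have "K \<subseteq> (\<Union>e\<in>{0<..}. U e)"
  proof
    fix y assume y: "y \<in> K"
    have "\<exists>e>0. N (y - x - e *\<^sub>R v) < r"
    proof (cases "N (y - x) = r")
      case False
      \<comment> \<open>A point with slack \<open>d\<close> tolerates any step of norm below
        \<open>d\<close>; the \<open>+ 1\<close> covers \<open>N v = 0\<close>.\<close>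
      define d where "d = r - N (y - x)"
      define e where "e = d / (N v + 1)"
      have d: "d > 0" using False le[OF y] by (simp add: d_def)
      have Nv: "N v \<ge> 0" by (rule is_norm_nonneg)
      have "e > 0" using d Nv by (simp add: e_def)
      moreover have "e * N v < d" using d Nv by (simp add: e_def field_simps)
      ultimately show ?thesis
        using is_norm_triangle_diff[of "y - x" "e *\<^sub>R v"]
        by (intro exI[of _ e]) (auto simp: is_norm_scaleR d_def)
    qed (use y impr in blast)
    then show "y \<in> (\<Union>e\<in>{0<..}. U e)" by (auto simp: U_def)
  qed
  ultimately obtain E where E: "E \<subseteq> {0<..}" "finite E" "K \<subseteq> (\<Union>e\<in>E. U e)"
    using compactE_image[OF \<open>compact K\<close>, of "{0<..}" U] by blast
  \<comment> \<open>The 1 keeps \<open>Min\<close> meaningful for empty \<open>E\<close>.\<close>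
  define s where "s = Min (insert 1 E)"
  have s: "s > 0" "\<And>e. e \<in> E \<Longrightarrow> s \<le> e" using E by (auto simp: s_def)
  have "N (y - (x + s *\<^sub>R v)) < r" if y: "y \<in> K" for y
  proof -
    obtain e where "e \<in> E" "N (y - x - e *\<^sub>R v) < r" using E y by (auto simp: U_def)
    then have "N (y - x - s *\<^sub>R v) < r" using norm_diff_less_mono le y s by blast
    then show ?thesis by (simp add: diff_diff_eq)
  qed
  then show ?thesis by blast
qed

end

section \<open>Planar cones and simplices around a point\<close>

lemma compact_halfplane_cone:
  fixes C :: "(real ^ 2) set"
  assumes "compact C" "C \<noteq> {}" and pos: "\<And>c. c \<in> C \<Longrightarrow> inner g c > 0"
  obtains p q where "p \<in> C" "q \<in> C"
    "\<And>c. c \<in> C \<Longrightarrow> \<exists>a\<ge>0. \<exists>b\<ge>0. c = a *\<^sub>R p + b *\<^sub>R q"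
proof -
  \<comment> \<open>\<open>J\<close> is the quarter turn, so \<open>h c\<close> is the tangent of
    the signed angle from \<open>g\<close> to \<open>c\<close>. Its minimizer \<open>p\<close> and
    maximizer \<open>q\<close> bound the angular sector containing \<open>C\<close>.\<close>
  define J :: "real ^ 2 \<Rightarrow> real ^ 2" where "J c = (\<chi> i. if i = 1 then - c $ 2 else c $ 1)" for c
  define h where "h c = inner (J g) c / inner g c" for c
  have cont: "continuous_on C h"
    unfolding h_def using pos by (intro continuous_intros) force
  obtain p where p: "p \<in> C" "\<And>c. c \<in> C \<Longrightarrow> h p \<le> h c"
    using continuous_attains_inf[OF assms(1,2) cont] by blast
  obtain q where q: "q \<in> C" "\<And>c. c \<in> C \<Longrightarrow> h c \<le> h q"
    using continuous_attains_sup[OF assms(1,2) cont] by blast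
  have "g \<noteq> 0" using pos[OF p(1)] by auto
  \<comment> \<open>\<open>g\<close> and \<open>J g\<close> form an orthogonal basis, so these two
    inner products determine a vector.\<close>
  have eqI: "u = w" if "inner g u = inner g w" "inner (J g) u = inner (J g) w" for u w
  proof -
    have 0: "inner g (u - w) = 0" "inner (J g) (u - w) = 0" using that by (auto simp: inner_diff_right)
    define y where "y = u - w"
    have e: "g $ 1 * y $ 1 + g $ 2 * y $ 2 = 0" "g $ 1 * y $ 2 - g $ 2 * y $ 1 = 0"
      using 0 by (auto simp: J_def inner_vec_def sum_2 y_def)
    have "((g $ 1)\<^sup>2 + (g $ 2)\<^sup>2) * y $ 1 = 0" "((g $ 1)\<^sup>2 + (g $ 2)\<^sup>2) * y $ 2 = 0"
      using e by algebra+
    moreover have "(g $ 1)\<^sup>2 + (g $ 2)\<^sup>2 \<noteq> 0"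
      using \<open>g \<noteq> 0\<close> by (auto simp: vec_eq_iff forall_2 sum_power2_eq_zero_iff)
    ultimately have "y $ 1 = 0" "y $ 2 = 0" by (metis mult_eq_0_iff)+
    then show ?thesis by (simp add: y_def vec_eq_iff forall_2)
  qed
  have "\<exists>a\<ge>0. \<exists>b\<ge>0. c = a *\<^sub>R p + b *\<^sub>R q" if c: "c \<in> C" for c
  proof -
    obtain t where t: "0 \<le> t" "t \<le> 1" "h c = (1 - t) * h p + t * h q"
    proof (cases "h p = h q")
      case True
      then show ?thesis using that[of 0] p(2)[OF c] q(2)[OF c] by simp
    next
      case False
      then have "h q - h p > 0" using p(2)[OF q(1)] by simp
      define t where "t = (h c - h p) / (h q - h p)"
      have "0 \<le> t" "t \<le> 1"
        using \<open>h q - h p > 0\<close> p(2)[OF c] q(2)[OF c] by (auto simp: t_def)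
      moreover have "t * (h q - h p) = h c - h p"
        using \<open>h q - h p > 0\<close> by (simp add: t_def)
      then have "h c = (1 - t) * h p + t * h q" by (simp add: algebra_simps)
      ultimately show ?thesis by (rule that)
    qed
    \<comment> \<open>These coefficients give the two summands the shares \<open>1 - t\<close> and
      \<open>t\<close> of the \<open>g\<close>-component of \<open>c\<close>; the
      \<open>J g\<close>-components then match because \<open>h c\<close> is the corresponding
      average of \<open>h p\<close> and \<open>h q\<close>.\<close>
    define a where "a = (1 - t) * inner g c / inner g p"
    define b where "b = t * inner g c / inner g q"
    have J: "inner (J g) z = h z * inner g z" if "z \<in> C" for z
      using pos[OF that] by (simp add: h_def)
    have ab: "a * inner g p = (1 - t) * inner g c" "b * inner g q = t * inner g c"
      using pos[OF p(1)] pos[OF q(1)] by (auto simp: a_def b_def)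
    have "c = a *\<^sub>R p + b *\<^sub>R q"
    proof (rule eqI)
      show "inner g c = inner g (a *\<^sub>R p + b *\<^sub>R q)"
        by (simp add: inner_add_right ab algebra_simps)
      have "inner (J g) (a *\<^sub>R p + b *\<^sub>R q) = h p * (a * inner g p) + h q * (b * inner g q)"
        by (simp add: inner_add_right J p(1) q(1))
      also have "\<dots> = inner (J g) c"
        unfolding ab J[OF c] t(3) by (simp add: algebra_simps)
      finally show "inner (J g) c = inner (J g) (a *\<^sub>R p + b *\<^sub>R q)" ..
    qed
    moreover have "a \<ge> 0" "b \<ge> 0"
      using t pos[OF p(1)] pos[OF q(1)] pos[OF c] by (auto simp: a_def b_def)
    ultimately show ?thesis by blast
  qed
  then show thesis using that p(1) q(1) by blast
qed

text \<open>Take \<open>T\<close> of least cardinality with \<open>x\<close> in its hull. The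
  dimension bound of Caratheodory's theorem makes it affinely independent, and a zero coefficient
  would allow a point to be dropped. All coefficients are thus positive, which describes the
  relative interior of a simplex.\<close>

lemma caratheodory_rel_interior:
  fixes S :: "'a::euclidean_space set"
  assumes "x \<in> convex hull S"
  obtains T where "T \<subseteq> S" "\<not> affine_dependent T" "x \<in> rel_interior (convex hull T)"
proof -
  define Q where "Q T \<longleftrightarrow> finite T \<and> T \<subseteq> S \<and> x \<in> convex hull T" for T
  have "\<exists>T. Q T" using assms unfolding Q_def caratheodory[of S] by blast
  then obtain T where T: "Q T" "\<And>T'. Q T' \<Longrightarrow> card T \<le> card T'"
    using ex_has_least_nat[of Q _ card] by blast
  have fin: "finite T" using T(1) by (simp add: Q_def)
  have "x \<in> convex hull T" using T(1) by (simp add: Q_def)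
  then obtain T' where T': "finite T'" "T' \<subseteq> T" "int (card T') \<le> aff_dim T + 1" "x \<in> convex hull T'"
    unfolding caratheodory_aff_dim[of T] by blast
  then have "card T \<le> card T'" using T by (auto simp: Q_def)
  then have "aff_dim T = int (card T) - 1"
    using T'(3) aff_dim_le_card[OF fin] by linarith
  then have indep: "\<not> affine_dependent T" using fin by (simp add: affine_independent_iff_card)
  obtain u where u: "\<forall>t\<in>T. 0 \<le> u t" "sum u T = 1" "(\<Sum>t\<in>T. u t *\<^sub>R t) = x"
    using \<open>x \<in> convex hull T\<close> unfolding convex_hull_finite[OF fin] by blast
  have "u t > 0" if t: "t \<in> T" for t
  proof (rule ccontr)
    assume "\<not> u t > 0"
    then have 0: "u t = 0" using u(1) t by force
    have "sum u (T - {t}) = 1" "(\<Sum>t\<in>T - {t}. u t *\<^sub>R t) = x"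
      using u(2,3) 0 by (simp_all add: sum.remove[OF fin t])
    then have "x \<in> convex hull (T - {t})"
      using u(1) fin by (auto simp: convex_hull_finite)
    then have "card T \<le> card (T - {t})" using T by (auto simp: Q_def)
    then show False using t fin card_Diff1_less[of T t] by simp
  qed
  then have "x \<in> rel_interior (convex hull T)"
    using u indep by (auto simp: rel_interior_convex_hull_explicit)
  then show thesis using that indep T(1) by (auto simp: Q_def)
qed

section \<open>Critical points and the location of the center\<close>

lemma critical_setI:
  assumes N: "is_norm N" and "is_min_encl_center N K x"
    and y: "y \<in> K" "N (y - x) = min_encl_radius N K" "0 < min_encl_radius N K"
  shows "y \<in> critical_set N K x"
proof -
  let ?B = "norm_cball N x (min_encl_radius N K)"
  have KB: "K \<subseteq> ?B" using assms by (simp add: is_min_encl_center_def)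
  have nB: "y \<notin> interior ?B"
  proof
    assume "y \<in> interior ?B"
    then obtain e where e: "e > 0" "ball y e \<subseteq> ?B" by (meson mem_interior)
    have "y \<noteq> x" using y is_norm_eq_0[OF N, of 0] by auto
    \<comment> \<open>Pushing \<open>y\<close> outward from \<open>x\<close> by Euclidean length
      \<open>e / 2\<close> stays in \<open>ball y e\<close> but raises the \<open>N\<close>-distance
      to \<open>x\<close> above the radius.\<close>
    define d where "d = e / (2 * norm (y - x))"
    have d: "d > 0" using e \<open>y \<noteq> x\<close> by (simp add: d_def)
    have "y + d *\<^sub>R (y - x) \<in> ball y e"
      using e \<open>y \<noteq> x\<close> by (simp add: dist_norm d_def)
    then have "N (y + d *\<^sub>R (y - x) - x) \<le> min_encl_radius N K"
      using e by (auto simp: norm_cball_def)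
    moreover have "y + d *\<^sub>R (y - x) - x = (1 + d) *\<^sub>R (y - x)"
      by (simp add: algebra_simps)
    ultimately have "(1 + d) * min_encl_radius N K \<le> min_encl_radius N K"
      using d y(2) by (simp add: is_norm_scaleR[OF N])
    then show False using d y(3) by (simp add: algebra_simps mult_le_0_iff)
  qed
  then have "y \<notin> interior K" using interior_mono[OF KB] by blast
  then show ?thesis
    using nB y(1) KB closure_subset by (auto simp: critical_set_def frontier_def)
qed

lemma center_in_convex_hull:
  assumes N: "is_norm N" and K: "K \<noteq> {}" "compact K"
    and nc: "\<not> centrable N K" and center: "is_min_encl_center N K x"
  shows "x \<in> convex hull {y \<in> K. N (y - x) = min_encl_radius N K}"
proof (rule ccontr)
  define r where "r = min_encl_radius N K"
  define C where "C = (\<lambda>y. y - x) ` {y \<in> K. N (y - x) = r}"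
  assume "x \<notin> convex hull {y \<in> K. N (y - x) = min_encl_radius N K}"
  then have 0: "0 \<notin> convex hull C"
    using convex_hull_translation[of "- x" "{y \<in> K. N (y - x) = r}"]
    by (auto simp: C_def r_def)
  have le: "N (y - x) \<le> r" if "y \<in> K" for y
    using that center by (auto simp: r_def is_min_encl_center_def norm_cball_def)
  have dist: "N (y - z) < 2 * r" if "y \<in> K" "z \<in> K" for y z
    using not_centrable_dist_less[OF N nc center that] by (simp add: r_def)
  obtain y0 where "y0 \<in> K" using K by blast
  then have "r > 0" using dist[of y0 y0] is_norm_eq_0[OF N, of 0] by simp
  \<comment> \<open>A direction improving all points at distance \<open>r\<close> yields a center
    \<open>z\<close> with all distances below \<open>r\<close>. The largest of them is attained on
    \<open>K\<close>, so it is an enclosing radius smaller than the minimal one.\<close>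
  have no_impr: False if impr: "\<And>y. y \<in> K \<Longrightarrow> N (y - x) = r \<Longrightarrow> \<exists>e>0. N (y - x - e *\<^sub>R v) < r" for v
  proof -
    obtain z where z: "\<forall>y\<in>K. N (y - z) < r"
      using uniformly_improving_shift[OF N K(2) le impr] by blast
    have "continuous_on K (\<lambda>y. N (y - z))"
      by (intro is_norm_continuous_on_comp[OF N] continuous_intros)
    then obtain y where y: "y \<in> K" "\<forall>y'\<in>K. N (y' - z) \<le> N (y - z)"
      using continuous_attains_sup[OF K(2,1)] by blast
    then have "r \<le> N (y - z)"
      unfolding r_def using min_encl_radius_le[OF N K] by (auto simp: norm_cball_def)
    then show False using z y by force
  qed
  have "compact C"
  proof -
    have "closed {y. N (y - x) = r}"
      by (intro closed_Collect_eq is_norm_continuous_on_comp[OF N] continuous_intros)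
    then have "compact (K \<inter> {y. N (y - x) = r})" using K(2) by blast
    moreover have "K \<inter> {y. N (y - x) = r} = {y \<in> K. N (y - x) = r}" by auto
    ultimately show ?thesis
      unfolding C_def by (intro compact_continuous_image continuous_intros) auto
  qed
  \<comment> \<open>If \<open>C\<close> were empty, the premise of \<open>no_impr\<close> would hold
    vacuously.\<close>
  moreover have "C \<noteq> {}" using no_impr[of 0] by (auto simp: C_def)
  moreover obtain g b where "0 < b" "\<And>c. c \<in> convex hull C \<Longrightarrow> inner g c > b"
    using separating_hyperplane_closed_0[of "convex hull C"] 0 \<open>compact C\<close>
      compact_convex_hull compact_imp_closed by (metis convex_convex_hull)
  then have "inner g c > 0" if "c \<in> C" for c
    using that hull_subset[of C convex] by fastforce
  ultimately obtain p q where pq: "p \<in> C" "q \<in> C"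
    and cone: "\<And>c. c \<in> C \<Longrightarrow> \<exists>a\<ge>0. \<exists>b\<ge>0. c = a *\<^sub>R p + b *\<^sub>R q"
    using compact_halfplane_cone by blast
  have "N p = r" "N q = r" "N (p - q) < 2 * r" using pq dist by (auto simp: C_def)
  note less = norm_diff_less_in_cone[OF N \<open>r > 0\<close> this]
  show False
  proof (rule no_impr)
    fix y assume y: "y \<in> K" "N (y - x) = r"
    then obtain a b where "a \<ge> 0" "b \<ge> 0" "y - x = a *\<^sub>R p + b *\<^sub>R q"
      using cone[of "y - x"] by (auto simp: C_def)
    then show "\<exists>e>0. N (y - x - e *\<^sub>R (p + q)) < r" using less y(2) by blast
  qed
qed

theorem theorem2:
  fixes N :: "real ^ 2 \<Rightarrow> real" and K :: "(real ^ 2) set" and x :: "real ^ 2"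
  assumes "is_norm N"
    and "K \<noteq> {}" and "compact K" and "convex K"
    and "\<not> centrable N K"
    and "is_min_encl_center N K x"
  shows "\<exists>m \<in> {2, 3 :: nat}. \<exists>T \<subseteq> critical_set N K x.
           card T = m \<and> \<not> affine_dependent T \<and> x \<in> rel_interior (convex hull T)"
proof -
  obtain T where T: "T \<subseteq> {y \<in> K. N (y - x) = min_encl_radius N K}"
    "\<not> affine_dependent T" "x \<in> rel_interior (convex hull T)"
    using caratheodory_rel_interior center_in_convex_hull[OF assms(1,2,3,5,6)] by blast
  obtain y0 where "y0 \<in> K" using assms(2) by blast
  then have pos: "0 < min_encl_radius N K"
    using not_centrable_dist_less[OF assms(1,5,6), of y0 y0] is_norm_eq_0[OF assms(1), of 0] by simp
  have sub: "T \<subseteq> critical_set N K x"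
    using T(1) critical_setI[OF assms(1,6)] pos by blast
  have fin: "finite T" and dim: "aff_dim T = int (card T) - 1"
    using T(2) by (auto simp: affine_independent_iff_card)
  have "card T \<le> 3" using dim aff_dim_le_DIM[of T] by simp
  moreover have "card T \<noteq> 0" using T(3) fin by auto
  \<comment> \<open>A singleton would have to be \<open>{x}\<close>, but its point lies at positive
    distance from \<open>x\<close>.\<close>
  moreover have "card T \<noteq> 1"
  proof
    assume "card T = 1"
    then obtain t where "T = {t}" by (auto simp: card_1_singleton_iff)
    then show False using T(1,3) pos is_norm_eq_0[OF assms(1), of 0] by auto
  qed
  ultimately have "card T \<in> {2, 3}" by auto
  then show ?thesis using sub T(2,3) by blast
qed

end
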